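(* Let $X$ and $Y$ be independent real random variables with $\operatorname{var}X<\infty$ and $Y\in\mathcal L$, i.e. $Y$ is self-decomposable. For $\lambda\in\mathbb R$ let $V(\lambda):=\operatorname{var}\bigl(E(X\mid X+\lambda Y)\bigr)$. Then $V(\lambda)$ is monotone decreasing (in the non-strict sense) on $(0,\infty)$ and monotone increasing (in the non-strict sense) on $(-\infty,0)$.
   Context: A random variable $Y$ is self-decomposable (belongs to the class $\mathcal L$) if for every $c$ with $0<c<1$ there exists a random variable $U_c$, independent of $Y$, such that $Y$ is equal in law to $cY+U_c$. *)

theory Defs
  imports "HOL-Probability.Probability"
begin

text \<open>
  Self-decomposability is a property of the law of \<open>Y\<close>. The independent summand \<open>U\<close> need not
  live on the probability space carrying \<open>Y\<close>, which may be too small; it is required to exist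
  together with a copy \<open>Y'\<close> of \<open>Y\<close> on some probability space. Taking that space over the type
  of pairs of reals is no restriction, since only the joint law of \<open>(Y', U)\<close> matters.
\<close>

definition self_decomposable :: "'a measure \<Rightarrow> ('a \<Rightarrow> real) \<Rightarrow> bool" where
  "self_decomposable M Y \<longleftrightarrow>
     (\<forall>c::real. 0 < c \<and> c < 1 \<longrightarrow>
       (\<exists>(N :: (real \<times> real) measure) Y' U.
          prob_space N \<and>
          prob_space.indep_var N borel Y' borel U \<and>
          distr N borel Y' = distr M borel Y \<and>
          distr N borel (\<lambda>w. c * Y' w + U w) = distr M borel Y))"

definition cond_exp_given :: "'a measure \<Rightarrow> ('a \<Rightarrow> real) \<Rightarrow> ('a \<Rightarrow> real) \<Rightarrow> 'a \<Rightarrow> real" where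
  "cond_exp_given M X Z = real_cond_exp M (vimage_algebra (space M) Z borel) X"

definition var_cond_exp ::
    "'a measure \<Rightarrow> ('a \<Rightarrow> real) \<Rightarrow> ('a \<Rightarrow> real) \<Rightarrow> real \<Rightarrow> real" where
  "var_cond_exp M X Y l =
     prob_space.variance M (cond_exp_given M X (\<lambda>w. X w + l * Y w))"

end

theory Submission
  imports Defs
begin

text \<open>
  Write \<open>Z\<^sub>l = X + l Y\<close> and \<open>C\<^sub>l = E(X | Z\<^sub>l)\<close>. Since \<open>E C\<^sub>l = E X\<close>, the claim concerns
  \<open>E (C\<^sub>l\<^sup>2)\<close>. Best approximation in \<open>L\<^sup>2\<close> gives the variational formula
    \<open>E (C\<^sub>l\<^sup>2) = max\<^sub>g E (2 X g(Z\<^sub>l) - g(Z\<^sub>l)\<^sup>2)\<close>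
  over Borel \<open>g\<close> with \<open>g(Z\<^sub>l)\<close> square integrable
  (\<open>quadratic_functional_le\<close>, \<open>quadratic_functional_real_cond_exp\<close>). Its right-hand side depends
  only on the joint law of \<open>X\<close> and \<open>Y\<close>, so the copy of \<open>Y\<close> provided by self-decomposability may
  live on another probability space.

  Two points \<open>k\<close>, \<open>l\<close> of the same half-line with \<open>k\<close> nearer to \<open>0\<close> satisfy \<open>k = c l\<close> with
  \<open>0 < c < 1\<close>. Self-decomposability replaces \<open>Y\<close> by \<open>c Y + U\<close> with an independent \<open>U\<close>, and hence
  \<open>Z\<^sub>l\<close> by \<open>Z\<^sub>k + l U\<close>, a noisier observation than \<open>Z\<^sub>k\<close>. Let \<open>g\<close> be optimal for \<open>l\<close>.
  Conditioning on \<open>U = u\<close>, which leaves the law of \<open>(X, Y)\<close> unchanged, turns \<open>g\<close> into its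
  translate \<open>g(\<sqdot> + l u)\<close>, a competitor in the variational problem for \<open>k\<close>. Each conditional
  value is therefore at most \<open>E (C\<^sub>k\<^sup>2)\<close>, and so is their average \<open>E (C\<^sub>l\<^sup>2)\<close>
  (\<open>var_cond_exp_shrink\<close>).
\<close>

section \<open>Factorization through a generating map\<close>

text \<open>
  The Doob--Dynkin factorization: a function measurable with respect to the \<open>\<sigma>\<close>-algebra generated
  by \<open>Z\<close> can only depend on the value of \<open>Z\<close>. The sets of this \<open>\<sigma>\<close>-algebra are preimages under
  \<open>Z\<close>, which settles indicators, and the property passes to sums, multiples and monotone limits. It
  makes the conditional expectation a function of \<open>Z\<^sub>l\<close> that can be translated.
\<close>

lemma doob_dynkin_real:
  fixes f :: "'a \<Rightarrow> real"
  assumes Z: "Z \<in> S \<rightarrow> space N"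
    and f: "f \<in> borel_measurable (vimage_algebra S Z N)"
  obtains g where "g \<in> borel_measurable N" "\<And>w. w \<in> S \<Longrightarrow> f w = g (Z w)"
proof -
  \<comment> \<open>Nonnegative extended functions are closed under arbitrary suprema, so no convergence has to
    be checked for the factors; signs are dealt with afterwards.\<close>
  have factor: "\<exists>g\<in>borel_measurable N. \<forall>w\<in>S. u w = g (Z w)"
    if "u \<in> borel_measurable (vimage_algebra S Z N)" for u :: "'a \<Rightarrow> ennreal"
    using that
  proof (induction u rule: borel_measurable_induct)
    case (cong f g)
    then show ?case by auto
  next
    case (set A)
    then obtain B where "B \<in> sets N" "A = Z -` B \<inter> S"
      using sets_vimage_algebra2[OF Z] by auto
    then show ?case
      by (intro bexI[of _ "indicator B"]) (auto simp: indicator_def)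
  next
    case (mult u c)
    from mult(4) obtain g where "g \<in> borel_measurable N" "\<forall>w\<in>S. u w = g (Z w)" ..
    then show ?case by (intro bexI[of _ "\<lambda>z. c * g z"]) auto
  next
    case (add u v)
    obtain g where "g \<in> borel_measurable N" "\<forall>w\<in>S. u w = g (Z w)"
      using add.IH(1) ..
    moreover obtain h where "h \<in> borel_measurable N" "\<forall>w\<in>S. v w = h (Z w)"
      using add.IH(2) ..
    ultimately show ?case by (intro bexI[of _ "\<lambda>z. h z + g z"]) auto
  next
    case (seq U)
    have "\<forall>i. \<exists>g. g \<in> borel_measurable N \<and> (\<forall>w\<in>S. U i w = g (Z w))"
      using seq.IH by blast
    then obtain G where G: "\<And>i. G i \<in> borel_measurable N" "\<And>i w. w \<in> S \<Longrightarrow> U i w = G i (Z w)"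
      by metis
    then show ?case
      by (intro bexI[of _ "\<lambda>z. SUP i. G i z"]) (auto simp: image_image)
  qed
  note [measurable] = f
  obtain p where [measurable]: "p \<in> borel_measurable N"
    and p: "\<forall>w\<in>S. ennreal (f w) = p (Z w)"
    using factor[of "\<lambda>w. ennreal (f w)"] by auto
  obtain n where [measurable]: "n \<in> borel_measurable N"
    and n: "\<forall>w\<in>S. ennreal (- f w) = n (Z w)"
    using factor[of "\<lambda>w. ennreal (- f w)"] by auto
  show thesis
  proof
    show "(\<lambda>z. enn2real (p z) - enn2real (n z)) \<in> borel_measurable N" by measurable
    show "f w = enn2real (p (Z w)) - enn2real (n (Z w))" if "w \<in> S" for w
      unfolding p[rule_format, OF that, symmetric] n[rule_format, OF that, symmetric]
      by (cases "f w \<ge> 0") (simp_all add: ennreal_neg)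
  qed
qed

section \<open>Variational characterization of conditional expectation\<close>

lemma integrable_product_of_squares:
  fixes f g :: "'a \<Rightarrow> real"
  assumes [measurable]: "f \<in> borel_measurable M" "g \<in> borel_measurable M"
    and "integrable M (\<lambda>w. (f w)\<^sup>2)" "integrable M (\<lambda>w. (g w)\<^sup>2)"
  shows "integrable M (\<lambda>w. f w * g w)"
proof (rule Bochner_Integration.integrable_bound)
  show "integrable M (\<lambda>w. (f w)\<^sup>2 + (g w)\<^sup>2)" using assms by simp
  have "\<bar>a * b\<bar> \<le> a\<^sup>2 + b\<^sup>2" for a b :: real
  proof -
    have "0 \<le> (\<bar>a\<bar> - \<bar>b\<bar>)\<^sup>2" "0 \<le> a\<^sup>2" "0 \<le> b\<^sup>2" by simp_all
    moreover have "0 \<le> \<bar>a\<bar> * \<bar>b\<bar>" by simp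
    ultimately show ?thesis unfolding power2_diff abs_mult power2_abs by linarith
  qed
  then show "AE w in M. norm (f w * g w) \<le> norm ((f w)\<^sup>2 + (g w)\<^sup>2)"
    by simp
qed measurable

context finite_measure_subalgebra
begin

lemma square_integrable_real_cond_exp:
  assumes "integrable M X" "integrable M (\<lambda>w. (X w)\<^sup>2)"
  shows "integrable M (\<lambda>w. (real_cond_exp M F X w)\<^sup>2)"
proof (rule integrable_convex_cond_exp[where I = UNIV and q = "\<lambda>x. x\<^sup>2"])
  show "convex_on UNIV (\<lambda>x::real. x\<^sup>2)"
    by (rule convex_power2)
qed (use assms in auto)

text \<open>
  As \<open>G\<close> is \<open>F\<close>-measurable, \<open>X\<close> may be replaced by its conditional expectation \<open>C\<close> in
  \<open>E (X G)\<close>; the bound is then \<open>2 C G - G\<^sup>2 = C\<^sup>2 - (C - G)\<^sup>2 \<le> C\<^sup>2\<close>.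
\<close>

lemma quadratic_functional_le:
  assumes X: "integrable M X" "integrable M (\<lambda>w. (X w)\<^sup>2)"
    and G[measurable]: "G \<in> borel_measurable F" and G2: "integrable M (\<lambda>w. (G w)\<^sup>2)"
  shows "(\<integral>w. 2 * X w * G w - (G w)\<^sup>2 \<partial>M) \<le> (\<integral>w. (real_cond_exp M F X w)\<^sup>2 \<partial>M)"
proof -
  let ?C = "real_cond_exp M F X"
  have [measurable]: "G \<in> borel_measurable M" by (rule measurable_from_subalg[OF subalg G])
  have [measurable]: "X \<in> borel_measurable M" using X by simp
  have XG: "integrable M (\<lambda>w. G w * X w)"
    by (rule integrable_product_of_squares) (use X G2 in auto)
  note CG = real_cond_exp_intg[OF XG G]
  have "(\<integral>w. 2 * X w * G w - (G w)\<^sup>2 \<partial>M) = (\<integral>w. 2 * (G w * X w) - (G w)\<^sup>2 \<partial>M)"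
    by (simp add: mult_ac)
  also have "\<dots> = 2 * (\<integral>w. G w * X w \<partial>M) - (\<integral>w. (G w)\<^sup>2 \<partial>M)"
    using XG G2 by simp
  also have "\<dots> = (\<integral>w. 2 * (G w * ?C w) - (G w)\<^sup>2 \<partial>M)"
    using CG G2 by simp
  also have "\<dots> \<le> (\<integral>w. (?C w)\<^sup>2 \<partial>M)"
  proof (rule integral_mono)
    show "2 * (G w * ?C w) - (G w)\<^sup>2 \<le> (?C w)\<^sup>2" for w
      using zero_le_power2[of "G w - ?C w"] by (simp add: power2_diff)
  qed (use CG G2 square_integrable_real_cond_exp[OF X] in auto)
  finally show ?thesis .
qed

text \<open>The bound above is attained at the conditional expectation itself.\<close>

lemma quadratic_functional_real_cond_exp:
  assumes X: "integrable M X" "integrable M (\<lambda>w. (X w)\<^sup>2)"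
  shows "(\<integral>w. 2 * X w * real_cond_exp M F X w - (real_cond_exp M F X w)\<^sup>2 \<partial>M)
    = (\<integral>w. (real_cond_exp M F X w)\<^sup>2 \<partial>M)"
proof -
  let ?C = "real_cond_exp M F X"
  note C2 = square_integrable_real_cond_exp[OF X]
  have [measurable]: "X \<in> borel_measurable M" using X by simp
  have XC: "integrable M (\<lambda>w. ?C w * X w)"
    by (rule integrable_product_of_squares) (use X C2 in auto)
  have "(\<integral>w. 2 * X w * ?C w - (?C w)\<^sup>2 \<partial>M) = (\<integral>w. 2 * (?C w * X w) - (?C w)\<^sup>2 \<partial>M)"
    by (simp add: mult_ac)
  also have "\<dots> = 2 * (\<integral>w. ?C w * X w \<partial>M) - (\<integral>w. (?C w)\<^sup>2 \<partial>M)"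
    using XC C2 by simp
  also have "(\<integral>w. ?C w * X w \<partial>M) = (\<integral>w. (?C w)\<^sup>2 \<partial>M)"
    using real_cond_exp_intg(2)[OF XC] by (simp add: power2_eq_square)
  finally show ?thesis by simp
qed

end

lemma (in prob_space) variance_real_cond_exp:
  assumes F: "subalgebra M F" and X: "integrable M X" "integrable M (\<lambda>w. (X w)\<^sup>2)"
  shows "variance (real_cond_exp M F X) = (\<integral>w. (real_cond_exp M F X w)\<^sup>2 \<partial>M) - (expectation X)\<^sup>2"
proof -
  interpret finite_measure_subalgebra M F
    by unfold_locales (fact F)
  show ?thesis
    using variance_eq[OF real_cond_exp_int(1)[OF X(1)] square_integrable_real_cond_exp[OF X]]
      real_cond_exp_int(2)[OF X(1)] by simp
qed

section \<open>Self-decomposability at the level of laws\<close>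

text \<open>
  The law of an independent pair \<open>(X, Y)\<close> is reproduced by \<open>(X, c Y + U)\<close> once \<open>c Y + U\<close> has the
  law of \<open>Y\<close>. The variable \<open>u\<close> is placed outermost because the product integral will later be
  disintegrated over \<open>u\<close>.
\<close>

lemma pair_measure_smoothing:
  fixes \<mu> \<nu> \<rho> :: "real measure"
  assumes "prob_space \<mu>" "prob_space \<nu>" "prob_space \<rho>"
    and sets[measurable_cong]: "sets \<mu> = sets borel" "sets \<nu> = sets borel" "sets \<rho> = sets borel"
    and stable: "distr (\<nu> \<Otimes>\<^sub>M \<rho>) borel (\<lambda>(y, u). c * y + u) = \<nu>"
  shows "distr (\<rho> \<Otimes>\<^sub>M (\<mu> \<Otimes>\<^sub>M \<nu>)) (\<mu> \<Otimes>\<^sub>M \<nu>) (\<lambda>(u, x, y). (x, c * y + u)) = \<mu> \<Otimes>\<^sub>M \<nu>"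
proof -
  interpret mu: prob_space \<mu> by fact
  interpret nu: prob_space \<nu> by fact
  interpret rho: prob_space \<rho> by fact
  interpret nr: pair_prob_space \<nu> \<rho> ..
  interpret mn: pair_prob_space \<mu> \<nu> ..
  interpret rmn: pair_prob_space \<rho> "\<mu> \<Otimes>\<^sub>M \<nu>" ..
  show ?thesis
  proof (rule pair_measure_eqI[symmetric])
    fix A B assume AB[measurable]: "A \<in> sets \<mu>" "B \<in> sets \<nu>"
    then have [measurable]: "A \<in> sets borel" "B \<in> sets borel" using sets by auto
    let ?b = "\<lambda>y u. indicator B (c * y + u) :: ennreal"
    have "emeasure \<nu> B = emeasure (distr (\<nu> \<Otimes>\<^sub>M \<rho>) borel (\<lambda>(y, u). c * y + u)) B"
      by (simp only: stable)
    also have "\<dots> = (\<integral>\<^sup>+z. indicator B z \<partial>distr (\<nu> \<Otimes>\<^sub>M \<rho>) borel (\<lambda>(y, u). c * y + u))"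
      by simp
    also have "\<dots> = (\<integral>\<^sup>+(y, u). ?b y u \<partial>(\<nu> \<Otimes>\<^sub>M \<rho>))"
      by (subst nn_integral_distr) (auto simp: case_prod_unfold)
    also have "\<dots> = (\<integral>\<^sup>+u. \<integral>\<^sup>+y. ?b y u \<partial>\<nu> \<partial>\<rho>)"
      by (subst nr.nn_integral_snd[symmetric]) auto
    finally have B: "emeasure \<nu> B = (\<integral>\<^sup>+u. \<integral>\<^sup>+y. ?b y u \<partial>\<nu> \<partial>\<rho>)" .
    have "emeasure (distr (\<rho> \<Otimes>\<^sub>M (\<mu> \<Otimes>\<^sub>M \<nu>)) (\<mu> \<Otimes>\<^sub>M \<nu>) (\<lambda>(u, x, y). (x, c * y + u))) (A \<times> B)
      = (\<integral>\<^sup>+p. indicator (A \<times> B) p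
          \<partial>distr (\<rho> \<Otimes>\<^sub>M (\<mu> \<Otimes>\<^sub>M \<nu>)) (\<mu> \<Otimes>\<^sub>M \<nu>) (\<lambda>(u, x, y). (x, c * y + u)))"
      by simp
    also have "\<dots> = (\<integral>\<^sup>+(u, x, y). indicator A x * ?b y u \<partial>(\<rho> \<Otimes>\<^sub>M (\<mu> \<Otimes>\<^sub>M \<nu>)))"
      by (subst nn_integral_distr) (auto simp: case_prod_unfold indicator_times)
    also have "\<dots> = (\<integral>\<^sup>+u. \<integral>\<^sup>+p. indicator A (fst p) * ?b (snd p) u \<partial>(\<mu> \<Otimes>\<^sub>M \<nu>) \<partial>\<rho>)"
      by (subst mn.nn_integral_fst[symmetric]) (auto simp: case_prod_unfold)
    also have "\<dots> = (\<integral>\<^sup>+u. \<integral>\<^sup>+x. \<integral>\<^sup>+y. indicator A x * ?b y u \<partial>\<nu> \<partial>\<mu> \<partial>\<rho>)"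
      by (subst nu.nn_integral_fst[symmetric]) auto
    also have "\<dots> = (\<integral>\<^sup>+u. emeasure \<mu> A * (\<integral>\<^sup>+y. ?b y u \<partial>\<nu>) \<partial>\<rho>)"
      by (simp add: nn_integral_cmult nn_integral_multc)
    also have "\<dots> = emeasure \<mu> A * emeasure \<nu> B"
      unfolding B by (subst nn_integral_cmult) auto
    finally show "emeasure \<mu> A * emeasure \<nu> B
      = emeasure (distr (\<rho> \<Otimes>\<^sub>M (\<mu> \<Otimes>\<^sub>M \<nu>)) (\<mu> \<Otimes>\<^sub>M \<nu>) (\<lambda>(u, x, y). (x, c * y + u))) (A \<times> B)"
      by simp
  qed (auto intro: mu.sigma_finite_measure_axioms nu.sigma_finite_measure_axioms)
qed

text \<open>
  Only the law of the remainder \<open>U\<close> matters, so the auxiliary probability space in the definition of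
  self-decomposability can be discarded.
\<close>

lemma self_decomposable_remainder_law:
  assumes "prob_space M" and [measurable]: "Y \<in> borel_measurable M" and "self_decomposable M Y"
    and c: "0 < c" "c < 1"
  obtains \<rho> :: "real measure" where "prob_space \<rho>" "sets \<rho> = sets borel"
    "distr (distr M borel Y \<Otimes>\<^sub>M \<rho>) borel (\<lambda>(y, u). c * y + u) = distr M borel Y"
proof -
  obtain N :: "(real \<times> real) measure" and Y' U where N: "prob_space N"
    "prob_space.indep_var N borel Y' borel U" "distr N borel Y' = distr M borel Y"
    "distr N borel (\<lambda>w. c * Y' w + U w) = distr M borel Y"
    using assms(3) c unfolding self_decomposable_def by blast
  interpret N: prob_space N by fact
  have [measurable]: "Y' \<in> borel_measurable N" "U \<in> borel_measurable N"
    and J: "distr N borel Y' \<Otimes>\<^sub>M distr N borel U = distr N (borel \<Otimes>\<^sub>M borel) (\<lambda>w. (Y' w, U w))"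
    using N(2) by (auto simp: N.indep_var_distribution_eq)
  show thesis
  proof (rule that)
    show "prob_space (distr N borel U)" by (rule N.prob_space_distr) simp
    have "distr (distr N borel Y' \<Otimes>\<^sub>M distr N borel U) borel (\<lambda>(y, u). c * y + u)
      = distr N borel (\<lambda>w. c * Y' w + U w)"
      unfolding J by (subst distr_distr) (auto simp: comp_def)
    then show "distr (distr M borel Y \<Otimes>\<^sub>M distr N borel U) borel (\<lambda>(y, u). c * y + u) = distr M borel Y"
      using N(3,4) by simp
  qed simp
qed

section \<open>Monotonicity of the variance\<close>

text \<open>
  Averaging over the remainder \<open>u\<close>: the optimal \<open>g\<close> for \<open>l\<close> yields for almost every \<open>u\<close> a
  competitor \<open>g(\<sqdot> + l u)\<close> for \<open>c * l\<close>.
\<close>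

lemma var_cond_exp_shrink:
  fixes X Y :: "'a \<Rightarrow> real"
  assumes "prob_space M"
    and XM[measurable]: "X \<in> borel_measurable M" and YM[measurable]: "Y \<in> borel_measurable M"
    and indep: "prob_space.indep_var M borel X borel Y"
    and X: "integrable M X" "integrable M (\<lambda>w. (X w)\<^sup>2)"
    and sd: "self_decomposable M Y" and c: "0 < c" "c < 1"
  shows "var_cond_exp M X Y l \<le> var_cond_exp M X Y (c * l)"
proof -
  interpret prob_space M by fact
  define \<sigma> where "\<sigma> k = vimage_algebra (space M) (\<lambda>w. X w + k * Y w) borel" for k
  define C where "C k = real_cond_exp M (\<sigma> k) X" for k
  have sub: "subalgebra M (\<sigma> k)" for k
    unfolding \<sigma>_def subalgebra_def by (intro conjI sets_image_in_sets) simp_all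
  have fin: "finite_measure_subalgebra M (\<sigma> k)" for k
    by unfold_locales (fact sub)
  have var: "var_cond_exp M X Y k = (\<integral>w. (C k w)\<^sup>2 \<partial>M) - (expectation X)\<^sup>2" for k
    using variance_real_cond_exp[OF sub X] unfolding var_cond_exp_def cond_exp_given_def C_def \<sigma>_def .
  obtain g where g[measurable]: "g \<in> borel_measurable borel"
    and Cg: "\<And>w. w \<in> space M \<Longrightarrow> C l w = g (X w + l * Y w)"
  proof (rule doob_dynkin_real[of "\<lambda>w. X w + l * Y w" "space M" borel "C l"])
    show "C l \<in> borel_measurable (vimage_algebra (space M) (\<lambda>w. X w + l * Y w) borel)"
      unfolding C_def \<sigma>_def by simp
  qed auto
  define \<mu> \<nu> where "\<mu> = distr M borel X" and "\<nu> = distr M borel Y"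
  have [measurable_cong]: "sets \<mu> = sets borel" "sets \<nu> = sets borel"
    by (simp_all add: \<mu>_def \<nu>_def)
  obtain \<rho> where "prob_space \<rho>" and [measurable_cong]: "sets \<rho> = sets borel"
    and stable: "distr (\<nu> \<Otimes>\<^sub>M \<rho>) borel (\<lambda>(y, u). c * y + u) = \<nu>"
    using self_decomposable_remainder_law[OF \<open>prob_space M\<close> YM sd c] unfolding \<nu>_def by blast
  interpret mu: prob_space \<mu> unfolding \<mu>_def by (rule prob_space_distr) simp
  interpret nu: prob_space \<nu> unfolding \<nu>_def by (rule prob_space_distr) simp
  interpret rho: prob_space \<rho> by fact
  interpret mn: pair_prob_space \<mu> \<nu> ..
  interpret rmn: pair_prob_space \<rho> "\<mu> \<Otimes>\<^sub>M \<nu>" ..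
  let ?T = "\<lambda>(u, x, y). (x, c * y + u)"
  have joint: "\<mu> \<Otimes>\<^sub>M \<nu> = distr M (borel \<Otimes>\<^sub>M borel) (\<lambda>w. (X w, Y w))"
    using indep unfolding indep_var_distribution_eq \<mu>_def \<nu>_def by auto
  have int_joint: "integrable (\<mu> \<Otimes>\<^sub>M \<nu>) f \<longleftrightarrow> integrable M (\<lambda>w. f (X w, Y w))"
    "(\<integral>p. f p \<partial>(\<mu> \<Otimes>\<^sub>M \<nu>)) = (\<integral>w. f (X w, Y w) \<partial>M)"
    if "f \<in> borel_measurable (borel \<Otimes>\<^sub>M borel)" for f :: "real \<times> real \<Rightarrow> real"
    unfolding joint using that by (subst integrable_distr_eq integral_distr; simp)+
  have smooth: "\<mu> \<Otimes>\<^sub>M \<nu> = distr (\<rho> \<Otimes>\<^sub>M (\<mu> \<Otimes>\<^sub>M \<nu>)) (\<mu> \<Otimes>\<^sub>M \<nu>) ?T"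
    by (rule pair_measure_smoothing[symmetric])
      (use stable in \<open>auto intro: mu.prob_space_axioms nu.prob_space_axioms rho.prob_space_axioms
        simp: \<open>sets \<mu> = sets borel\<close> \<open>sets \<nu> = sets borel\<close> \<open>sets \<rho> = sets borel\<close>\<close>)
  have int_smooth: "integrable (\<rho> \<Otimes>\<^sub>M (\<mu> \<Otimes>\<^sub>M \<nu>)) (\<lambda>r. f (?T r))"
    "(\<integral>p. f p \<partial>(\<mu> \<Otimes>\<^sub>M \<nu>)) = (\<integral>r. f (?T r) \<partial>(\<rho> \<Otimes>\<^sub>M (\<mu> \<Otimes>\<^sub>M \<nu>)))"
    if "integrable (\<mu> \<Otimes>\<^sub>M \<nu>) f" for f :: "real \<times> real \<Rightarrow> real"
  proof -
    have [measurable]: "f \<in> borel_measurable (\<mu> \<Otimes>\<^sub>M \<nu>)" using that by simp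
    have T: "?T \<in> \<rho> \<Otimes>\<^sub>M (\<mu> \<Otimes>\<^sub>M \<nu>) \<rightarrow>\<^sub>M \<mu> \<Otimes>\<^sub>M \<nu>" by measurable
    show "integrable (\<rho> \<Otimes>\<^sub>M (\<mu> \<Otimes>\<^sub>M \<nu>)) (\<lambda>r. f (?T r))"
      using that by (subst (asm) smooth) (rule integrable_distr[OF T])
    show "(\<integral>p. f p \<partial>(\<mu> \<Otimes>\<^sub>M \<nu>)) = (\<integral>r. f (?T r) \<partial>(\<rho> \<Otimes>\<^sub>M (\<mu> \<Otimes>\<^sub>M \<nu>)))"
      by (subst smooth) (rule integral_distr[OF T], simp)
  qed
  \<comment> \<open>The integrand of the variational formula and the square that makes it integrable, as
    functions of the values of \<open>X\<close> and \<open>Y\<close>.\<close>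
  define sq q :: "real \<times> real \<Rightarrow> real"
    where "sq = (\<lambda>(x, y). (g (x + l * y))\<^sup>2)"
      and "q = (\<lambda>(x, y). 2 * x * g (x + l * y) - (g (x + l * y))\<^sup>2)"
  have [measurable]: "sq \<in> borel_measurable (borel \<Otimes>\<^sub>M borel)" "q \<in> borel_measurable (borel \<Otimes>\<^sub>M borel)"
    unfolding sq_def q_def by measurable
  have sqM: "integrable M (\<lambda>w. (g (X w + l * Y w))\<^sup>2)"
    using finite_measure_subalgebra.square_integrable_real_cond_exp[OF fin X, of l] Cg
    unfolding C_def[symmetric] by (simp cong: Bochner_Integration.integrable_cong)
  have "integrable M (\<lambda>w. X w * g (X w + l * Y w))"
    by (rule integrable_product_of_squares) (use X sqM in auto)
  then have "integrable M (\<lambda>w. 2 * (X w * g (X w + l * Y w)) - (g (X w + l * Y w))\<^sup>2)"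
    using sqM by simp
  then have q_int: "integrable (\<mu> \<Otimes>\<^sub>M \<nu>) q"
    by (simp add: int_joint) (simp add: q_def mult.assoc)
  have sq_int: "integrable (\<mu> \<Otimes>\<^sub>M \<nu>) sq"
    using sqM by (simp add: int_joint) (simp add: sq_def)
  \<comment> \<open>A translate of \<open>g\<close> is admissible for \<open>c * l\<close> only if it is square integrable there;
    by Fubini this fails at most on a null set of \<open>u\<close>.\<close>
  have section_le: "(\<integral>p. q (?T (u, p)) \<partial>(\<mu> \<Otimes>\<^sub>M \<nu>)) \<le> (\<integral>w. (C (c * l) w)\<^sup>2 \<partial>M)"
    if "integrable (\<mu> \<Otimes>\<^sub>M \<nu>) (\<lambda>p. sq (?T (u, p)))" for u
  proof -
    define G where "G w = g (X w + c * l * Y w + l * u)" for w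
    have "(\<lambda>w. X w + c * l * Y w) \<in> borel_measurable (\<sigma> (c * l))"
      unfolding \<sigma>_def by (rule measurable_vimage_algebra1) simp
    then have G: "G \<in> borel_measurable (\<sigma> (c * l))"
      unfolding G_def by measurable
    have *: "x + l * (c * y + u) = x + c * l * y + l * u" for x y
      by (simp add: algebra_simps)
    have G2: "integrable M (\<lambda>w. (G w)\<^sup>2)"
      using that by (subst (asm) int_joint(1)) (auto simp: sq_def G_def * case_prod_unfold)
    have "(\<integral>p. q (?T (u, p)) \<partial>(\<mu> \<Otimes>\<^sub>M \<nu>)) = (\<integral>w. 2 * X w * G w - (G w)\<^sup>2 \<partial>M)"
      by (subst int_joint(2)) (auto simp: q_def G_def * case_prod_unfold)
    also have "\<dots> \<le> (\<integral>w. (C (c * l) w)\<^sup>2 \<partial>M)"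
      unfolding C_def by (rule finite_measure_subalgebra.quadratic_functional_le[OF fin X G G2])
    finally show ?thesis .
  qed
  have "(\<integral>w. (C l w)\<^sup>2 \<partial>M) = (\<integral>w. 2 * X w * C l w - (C l w)\<^sup>2 \<partial>M)"
    unfolding C_def by (rule finite_measure_subalgebra.quadratic_functional_real_cond_exp[OF fin X, symmetric])
  also have "\<dots> = (\<integral>w. q (X w, Y w) \<partial>M)"
    by (rule Bochner_Integration.integral_cong) (simp_all add: Cg q_def)
  also have "\<dots> = (\<integral>p. q p \<partial>(\<mu> \<Otimes>\<^sub>M \<nu>))"
    by (simp add: int_joint)
  also have "\<dots> = (\<integral>r. q (?T r) \<partial>(\<rho> \<Otimes>\<^sub>M (\<mu> \<Otimes>\<^sub>M \<nu>)))"
    by (rule int_smooth(2)[OF q_int])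
  also have "\<dots> = (\<integral>u. (\<integral>p. q (?T (u, p)) \<partial>(\<mu> \<Otimes>\<^sub>M \<nu>)) \<partial>\<rho>)"
    by (rule rmn.integral_fst'[OF int_smooth(1)[OF q_int], symmetric])
  also have "\<dots> \<le> (\<integral>w. (C (c * l) w)\<^sup>2 \<partial>M)"
  proof (rule rho.integral_le_const)
    show "integrable \<rho> (\<lambda>u. \<integral>p. q (?T (u, p)) \<partial>(\<mu> \<Otimes>\<^sub>M \<nu>))"
      by (rule rmn.integrable_fst'[OF int_smooth(1)[OF q_int]])
    show "AE u in \<rho>. (\<integral>p. q (?T (u, p)) \<partial>(\<mu> \<Otimes>\<^sub>M \<nu>)) \<le> (\<integral>w. (C (c * l) w)\<^sup>2 \<partial>M)"
      using rmn.AE_integrable_fst'[OF int_smooth(1)[OF sq_int]] by (rule eventually_mono) (rule section_le)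
  qed
  finally show ?thesis by (simp add: var)
qed

theorem theorem2:
  fixes M :: "'a measure" and X Y :: "'a \<Rightarrow> real"
  assumes "prob_space M"
    and "X \<in> borel_measurable M" and "Y \<in> borel_measurable M"
    and "prob_space.indep_var M borel X borel Y"
    and "integrable M X"
    and "integrable M (\<lambda>w. (X w - prob_space.expectation M X)\<^sup>2)"
    and "self_decomposable M Y"
  shows "antimono_on {0<..} (var_cond_exp M X Y) \<and> mono_on {..<0} (var_cond_exp M X Y)"
proof -
  interpret prob_space M by fact
  let ?m = "expectation X"
  have "integrable M (\<lambda>w. (X w - ?m)\<^sup>2 + 2 * ?m * X w - ?m\<^sup>2)"
    using assms(5,6) by simp
  then have X2: "integrable M (\<lambda>w. (X w)\<^sup>2)"
    by (simp add: power2_diff algebra_simps)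
  note shrink = var_cond_exp_shrink[OF assms(1-5) X2 assms(7)]
  \<comment> \<open>The ratio is positive on either half-line, so both claims are instances of shrinking the
    parameter towards \<open>0\<close>.\<close>
  have le: "var_cond_exp M X Y b \<le> var_cond_exp M X Y a" if "0 < a / b" "a / b \<le> 1" for a b
  proof (cases "a / b = 1")
    case True
    then have "a = b" by (metis divide_eq_1_iff)
    then show ?thesis by simp
  next
    case False
    with that have "a / b < 1" by linarith
    moreover have "a / b * b = a" using that by auto
    ultimately show ?thesis using shrink[of "a / b" b] that(1) by metis
  qed
  show ?thesis
  proof (intro conjI monotone_onI)
    fix a b :: real assume "a \<in> {0<..}" "b \<in> {0<..}" "a \<le> b"
    then show "var_cond_exp M X Y b \<le> var_cond_exp M X Y a" by (intro le) auto
  next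
    fix a b :: real assume "a \<in> {..<0}" "b \<in> {..<0}" "a \<le> b"
    then show "var_cond_exp M X Y a \<le> var_cond_exp M X Y b"
      by (intro le) (auto simp: divide_simps)
  qed
qed

end
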